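(* For nonzero parameters $a,b,c\in\mathbb C$, the map $$T_{a,b,c}:(x_1,x_2,y_1,y_2,z_1,z_2)\mapsto\left(y_1,\ \frac{ax_1^2x_2y_2}{(ay_1y_2+bx_1^2x_2z_2)z_1},\ x_1,\ \frac{bx_2z_1z_2}{ac},\ \frac{y_1z_1}{x_1},\ \frac{ay_1y_2+bx_1^2x_2z_2}{ax_1x_2y_1}\right)$$ is a six-dimensional parametric tetrahedron map, and it is noninvolutive and birational. Additionally, it admits the invariants $$I_1=x_1+y_1,\qquad I_2=y_1z_1,\qquad I_3=\frac{x_1}{z_1}.$$
   Context: All maps are rational maps and identities between them are understood as identities of rational functions. The components of the image are denoted $(u_1,u_2,v_1,v_2,w_1,w_2)$; a function $I$ is an invariant if replacing $x_i,y_i,z_i$ by $u_i,v_i,w_i$ does not change its value. Birational means that the map has a rational inverse; noninvolutive means $T_{a,b,c}\circ T_{a,b,c}\neq\mathrm{id}$. Parametric tetrahedron map: a family of rational maps $T_{a,b,c}:\mathcal X^3\to\mathcal X^3$ is a parametric tetrahedron map if $$T^{123}_{a,b,c}\circ T^{145}_{a,d,e}\circ T^{246}_{b,d,f}\circ T^{356}_{c,e,f}=T^{356}_{c,e,f}\circ T^{246}_{b,d,f}\circ T^{145}_{a,d,e}\circ T^{123}_{a,b,c}$$ on $\mathcal X^6$ for all parameters $a,b,c,d,e,f$, where $T^{ijk}$ acts as $T$ on the $i$-th, $j$-th, $k$-th factors (in this order) of $\mathcal X^6$ and as the identity on the others. Here $\mathcal X=\mathbb C^2$, the three factors having coordinates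 $(x_1,x_2)$, $(y_1,y_2)$, $(z_1,z_2)$ and the image $(u_1,u_2)$, $(v_1,v_2)$, $(w_1,w_2)$. *)

theory Defs
  imports
    Complex_Main
    "HOL-Library.Poly_Mapping"
    "HOL-Library.Numeral_Type"
    "HOL-Computational_Algebra.Fraction_Field"
begin

section \<open>Rational functions over the complex numbers\<close>

text \<open>
  Polynomials are finitely supported maps from monomials (exponent vectors) to coefficients.
  A linear order on the variables is needed only to make the polynomial ring an integral domain
  as a type class instance, so that its fraction field can be formed.
\<close>

type_synonym 'v cpoly = "('v \<Rightarrow>\<^sub>0 nat) \<Rightarrow>\<^sub>0 complex"

type_synonym 'v ratfun = "'v cpoly fract"

definition cst :: "complex \<Rightarrow> 'v::linorder ratfun" where
  "cst c = Fract (Poly_Mapping.single 0 c) 1"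

definition Var :: "'v \<Rightarrow> 'v::linorder ratfun" where
  "Var v = Fract (Poly_Mapping.single (Poly_Mapping.single v 1) 1) 1"

definition poly_subst :: "('v \<Rightarrow> 'w ratfun) \<Rightarrow> 'v::linorder cpoly \<Rightarrow> 'w::linorder ratfun" where
  "poly_subst g p =
     (\<Sum>m\<in>Poly_Mapping.keys p.
        cst (Poly_Mapping.lookup p m) * (\<Prod>v\<in>Poly_Mapping.keys m. g v ^ Poly_Mapping.lookup m v))"

text \<open>
  Substituting rational functions \<open>g\<close> into \<open>f\<close> makes sense iff \<open>f\<close> has a representation \<open>p / q\<close>
  whose denominator does not become the zero rational function. The result does not depend on the
  representation, and \<open>rat_subst\<close> is unspecified if there is none; every use below
  either requires definedness or is a mere renaming of variables.
\<close>

definition rat_subst_defined :: "('v \<Rightarrow> 'w::linorder ratfun) \<Rightarrow> 'v::linorder ratfun \<Rightarrow> bool" where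
  "rat_subst_defined g f \<longleftrightarrow> (\<exists>p q. f = Fract p q \<and> poly_subst g q \<noteq> 0)"

definition rat_subst :: "('v \<Rightarrow> 'w::linorder ratfun) \<Rightarrow> 'v::linorder ratfun \<Rightarrow> 'w ratfun" where
  "rat_subst g f =
     (THE h. \<exists>p q. f = Fract p q \<and> poly_subst g q \<noteq> 0 \<and> h = poly_subst g p / poly_subst g q)"


section \<open>Rational maps\<close>

text \<open>
  A rational map from the affine space with coordinates \<open>'v\<close> to the one with coordinates \<open>'w\<close>:
  one rational function in the variables \<open>'v\<close> for each coordinate \<open>'w\<close> of the target.
  Equality of such maps is equality of their components as rational functions.
\<close>

type_synonym ('v, 'w) ratmap = "'w \<Rightarrow> 'v ratfun"

definition rat_comp_defined ::
  "('v::linorder, 'w::linorder) ratmap \<Rightarrow> ('u::linorder, 'v) ratmap \<Rightarrow> bool" where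
  "rat_comp_defined G F \<longleftrightarrow> (\<forall>w. rat_subst_defined F (G w))"

definition rat_comp ::
  "('v::linorder, 'w::linorder) ratmap \<Rightarrow> ('u::linorder, 'v) ratmap \<Rightarrow> ('u, 'w) ratmap" where
  "rat_comp G F = (\<lambda>w. rat_subst F (G w))"

text \<open>
  \<open>rat_comps [F1, \<dots>, Fn]\<close> is the composite of \<open>F1\<close> after \<open>\<dots>\<close> after \<open>Fn\<close>
  (\<open>Fn\<close> is applied first), or \<open>None\<close> if one of the compositions is undefined.
\<close>

fun rat_comps :: "('v::linorder, 'v) ratmap list \<Rightarrow> ('v, 'v) ratmap option" where
  "rat_comps [] = Some Var"
| "rat_comps (F # Fs) =
     (case rat_comps Fs of
        None \<Rightarrow> None
      | Some G \<Rightarrow> if rat_comp_defined F G then Some (rat_comp F G) else None)"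

definition birational :: "('v::linorder, 'w::linorder) ratmap \<Rightarrow> bool" where
  "birational F \<longleftrightarrow>
     (\<exists>G :: ('w, 'v) ratmap.
        rat_comp_defined G F \<and> rat_comp G F = Var \<and>
        rat_comp_defined F G \<and> rat_comp F G = Var)"

definition noninvolutive :: "('v::linorder, 'v) ratmap \<Rightarrow> bool" where
  "noninvolutive F \<longleftrightarrow> rat_comp_defined F F \<and> rat_comp F F \<noteq> Var"

definition rat_invariant :: "('v::linorder, 'v) ratmap \<Rightarrow> 'v ratfun \<Rightarrow> bool" where
  "rat_invariant F I \<longleftrightarrow> rat_subst_defined F I \<and> rat_subst F I = I"


section \<open>Parametric tetrahedron maps\<close>

text \<open>
  Coordinates of a power of the affine space with coordinates \<open>'s\<close>:
  \<open>Coord i s\<close> is the coordinate \<open>s\<close> of the \<open>i\<close>-th factor.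
\<close>

datatype ('i, 's) coord = Coord (factor: 'i) (component: 's)

instantiation coord :: (linorder, linorder) linorder
begin

definition less_eq_coord :: "('a, 'b) coord \<Rightarrow> ('a, 'b) coord \<Rightarrow> bool" where
  "p \<le> q \<longleftrightarrow> factor p < factor q \<or> factor p = factor q \<and> component p \<le> component q"

definition less_coord :: "('a, 'b) coord \<Rightarrow> ('a, 'b) coord \<Rightarrow> bool" where
  "p < q \<longleftrightarrow> factor p < factor q \<or> factor p = factor q \<and> component p < component q"

instance
  by standard (auto simp: less_eq_coord_def less_coord_def intro: coord.expand)

end

text \<open>
  The factors are labelled by the finite types \<open>3\<close> and \<open>6\<close>. Arithmetic in these types is cyclic,
  so \<open>3 = 0\<close> in type \<open>3\<close> and \<open>6 = 0\<close> in type \<open>6\<close>; hence \<open>1, 2, 3\<close>, respectively \<open>1, \<dots>, 6\<close>,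
  enumerate all elements without repetition.
\<close>

definition place :: "'i \<Rightarrow> 'i \<Rightarrow> 'i \<Rightarrow> 3 \<Rightarrow> 'i" where
  "place i j k l = (if l = 1 then i else if l = 2 then j else k)"

text \<open>
  \<open>act_on i j k T\<close> acts as \<open>T\<close> on the factors \<open>i\<close>, \<open>j\<close>, \<open>k\<close> (assumed distinct), in this order,
  and as the identity on the others.
\<close>

definition act_on ::
  "'i \<Rightarrow> 'i \<Rightarrow> 'i \<Rightarrow> ((3, 's) coord, (3, 's) coord) ratmap
     \<Rightarrow> (('i::linorder, 's::linorder) coord, ('i, 's) coord) ratmap" where
  "act_on i j k T =
     (let rename = rat_subst (\<lambda>p. Var (Coord (place i j k (factor p)) (component p)))
      in (\<lambda>q. if factor q = i then rename (T (Coord 1 (component q)))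
             else if factor q = j then rename (T (Coord 2 (component q)))
             else if factor q = k then rename (T (Coord 3 (component q)))
             else Var q))"

text \<open>
  The parameters range over \<open>P\<close>. Both composites are required to be defined.
\<close>

definition parametric_tetrahedron_map ::
  "'p set \<Rightarrow> ('p \<Rightarrow> 'p \<Rightarrow> 'p \<Rightarrow> ((3, 's::linorder) coord, (3, 's) coord) ratmap) \<Rightarrow> bool" where
  "parametric_tetrahedron_map P T \<longleftrightarrow>
     (\<forall>a\<in>P. \<forall>b\<in>P. \<forall>c\<in>P. \<forall>d\<in>P. \<forall>e\<in>P. \<forall>f\<in>P.
        let T123 = act_on (1::6) 2 3 (T a b c);
            T145 = act_on (1::6) 4 5 (T a d e);
            T246 = act_on (2::6) 4 6 (T b d f);
            T356 = act_on (3::6) 5 6 (T c e f)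
        in rat_comps [T123, T145, T246, T356] \<noteq> None \<and>
           rat_comps [T123, T145, T246, T356] = rat_comps [T356, T246, T145, T123])"


section \<open>The six-dimensional map\<close>

type_synonym coord6 = "(3, 2) coord"

abbreviation x1 :: "coord6 ratfun" where "x1 \<equiv> Var (Coord 1 1)"
abbreviation x2 :: "coord6 ratfun" where "x2 \<equiv> Var (Coord 1 2)"
abbreviation y1 :: "coord6 ratfun" where "y1 \<equiv> Var (Coord 2 1)"
abbreviation y2 :: "coord6 ratfun" where "y2 \<equiv> Var (Coord 2 2)"
abbreviation z1 :: "coord6 ratfun" where "z1 \<equiv> Var (Coord 3 1)"
abbreviation z2 :: "coord6 ratfun" where "z2 \<equiv> Var (Coord 3 2)"

definition six_tuple :: "'r \<Rightarrow> 'r \<Rightarrow> 'r \<Rightarrow> 'r \<Rightarrow> 'r \<Rightarrow> 'r \<Rightarrow> coord6 \<Rightarrow> 'r" where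
  "six_tuple u1 u2 v1 v2 w1 w2 p =
     (if factor p = 1 then (if component p = 1 then u1 else u2)
      else if factor p = 2 then (if component p = 1 then v1 else v2)
      else (if component p = 1 then w1 else w2))"

definition tetra_map :: "complex \<Rightarrow> complex \<Rightarrow> complex \<Rightarrow> (coord6, coord6) ratmap" where
  "tetra_map a b c = six_tuple
     y1
     (cst a * x1^2 * x2 * y2 / ((cst a * y1 * y2 + cst b * x1^2 * x2 * z2) * z1))
     x1
     (cst b * x2 * z1 * z2 / (cst a * cst c))
     (y1 * z1 / x1)
     ((cst a * y1 * y2 + cst b * x1^2 * x2 * z2) / (cst a * x1 * x2 * y1))"

end

theory Submission
  imports Defs
begin

text \<open>
  A rational map \<open>F\<close> along which no nonzero polynomial vanishes, as is the case whenever \<open>F\<close> has a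
  left inverse, induces a field homomorphism \<open>rat_subst F\<close> on rational functions, so all compositions
  with it are defined. The tetrahedron map is inverted explicitly: \<open>x\<^sub>1, y\<^sub>1, z\<^sub>1\<close> are \<open>v\<^sub>1, u\<^sub>1, v\<^sub>1 w\<^sub>1 / u\<^sub>1\<close>,
  then \<open>y\<^sub>2 = u\<^sub>2 w\<^sub>1 w\<^sub>2\<close>, and \<open>v\<^sub>2\<close> gives \<open>x\<^sub>2 z\<^sub>2\<close>, hence the denominator \<open>a y\<^sub>1 y\<^sub>2 + b x\<^sub>1\<^sup>2 x\<^sub>2 z\<^sub>2\<close> and, through \<open>w\<^sub>2\<close>, \<open>x\<^sub>2\<close>.
  The tetrahedron equation thereby becomes an identity in the field of rational functions.
\<close>

section \<open>Substitution into rational functions\<close>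

abbreviation monom_subst :: "('v \<Rightarrow> 'w::linorder ratfun) \<Rightarrow> ('v \<Rightarrow>\<^sub>0 nat) \<Rightarrow> 'w ratfun" where
  "monom_subst g m \<equiv> \<Prod>v\<in>Poly_Mapping.keys m. g v ^ Poly_Mapping.lookup m v"

text \<open>Outside the support the exponent is 0 and the factor is 1, so monomials with different
  supports can be compared over one index set.\<close>

lemma monom_subst_superset:
  assumes "finite A" "Poly_Mapping.keys m \<subseteq> A"
  shows "monom_subst g m = (\<Prod>v\<in>A. g v ^ Poly_Mapping.lookup m v)"
  using assms by (intro prod.mono_neutral_left) (auto simp: in_keys_iff)

lemma monom_subst_add: "monom_subst g (m + n) = monom_subst g m * monom_subst g n"
proof -
  let ?A = "Poly_Mapping.keys m \<union> Poly_Mapping.keys n"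
  have "Poly_Mapping.keys (m + n) \<subseteq> ?A" by (rule keys_add)
  then have "monom_subst g (m + n) = (\<Prod>v\<in>?A. g v ^ Poly_Mapping.lookup (m + n) v)"
    by (intro monom_subst_superset) auto
  also have "\<dots> = (\<Prod>v\<in>?A. g v ^ Poly_Mapping.lookup m v) * (\<Prod>v\<in>?A. g v ^ Poly_Mapping.lookup n v)"
    by (simp add: lookup_add power_add prod.distrib)
  also have "\<dots> = monom_subst g m * monom_subst g n"
    by (subst (1 2) monom_subst_superset[where A = ?A]) auto
  finally show ?thesis .
qed

lemma cst_add: "cst (a + b) = cst a + cst b"
  by (simp add: cst_def single_add)

lemma cst_mult: "cst (a * b) = cst a * cst b"
  by (simp add: cst_def mult_single)

lemma cst_0 [simp]: "cst 0 = 0"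
  by (simp add: cst_def Zero_fract_def)

lemma cst_1 [simp]: "cst 1 = 1"
  by (simp add: cst_def One_fract_def)

lemma cst_eq_0_iff [simp]: "(cst a :: 'v::linorder ratfun) = 0 \<longleftrightarrow> a = 0"
proof
  assume "cst a = (0 :: 'v ratfun)"
  then have "Poly_Mapping.single (0 :: 'v \<Rightarrow>\<^sub>0 nat) a = 0"
    by (simp add: cst_def Zero_fract_def eq_fract)
  then have "Poly_Mapping.lookup (Poly_Mapping.single (0 :: 'v \<Rightarrow>\<^sub>0 nat) a) 0 = 0" by simp
  then show "a = 0" by simp
qed simp

lemma Var_neq_0 [simp]: "Var v \<noteq> 0"
proof
  assume "Var v = 0"
  then have "Poly_Mapping.single (Poly_Mapping.single v (1::nat)) (1::complex) = 0"
    by (simp add: Var_def Zero_fract_def eq_fract)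
  from arg_cong[OF this, of "\<lambda>p. Poly_Mapping.lookup p (Poly_Mapping.single v 1)"]
  show False by simp
qed

lemma poly_subst_single: "poly_subst g (Poly_Mapping.single m c) = cst c * monom_subst g m"
  by (simp add: poly_subst_def)

text \<open>Cancellation can shrink the support of \<open>p + q\<close>; this is harmless because
  each summand is additive in its coefficient and vanishes at coefficient 0.\<close>

lemma poly_subst_add: "poly_subst g (p + q) = poly_subst g p + poly_subst g q"
  unfolding poly_subst_def
  by (rule setsum_keys_plus_distrib) (simp_all add: cst_add algebra_simps)

lemma poly_subst_0 [simp]: "poly_subst g 0 = 0"
  by (simp add: poly_subst_def)

lemma poly_subst_1 [simp]: "poly_subst g 1 = 1"
  by (simp add: poly_subst_def)

lemma poly_subst_sum: "poly_subst g (sum f A) = (\<Sum>i\<in>A. poly_subst g (f i))"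
  by (induction A rule: infinite_finite_induct) (simp_all add: poly_subst_add)

lemma cpoly_eq_sum_single:
  "(\<Sum>m\<in>Poly_Mapping.keys p. Poly_Mapping.single m (Poly_Mapping.lookup p m)) = p"
  by (rule poly_mapping_eqI) (simp add: lookup_sum lookup_single when_def in_keys_iff)

text \<open>Expanding both factors into monomials reduces the claim to
  \<open>monom_subst_add\<close> and \<open>cst_mult\<close>.\<close>

lemma poly_subst_mult: "poly_subst g (p * q) = poly_subst g p * poly_subst g q"
proof -
  let ?s = "\<lambda>p m. Poly_Mapping.single m (Poly_Mapping.lookup p m)"
  let ?K = "Poly_Mapping.keys p" and ?L = "Poly_Mapping.keys q"
  have "p * q = (\<Sum>m\<in>?K. \<Sum>n\<in>?L. ?s p m * ?s q n)"
    by (subst (1) cpoly_eq_sum_single[of p, symmetric], subst (1) cpoly_eq_sum_single[of q, symmetric])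
      (simp only: sum_product)
  also have "poly_subst g \<dots> = (\<Sum>m\<in>?K. \<Sum>n\<in>?L. poly_subst g (?s p m) * poly_subst g (?s q n))"
    by (simp add: poly_subst_sum mult_single poly_subst_single cst_mult monom_subst_add algebra_simps)
  also have "\<dots> = poly_subst g (\<Sum>m\<in>?K. ?s p m) * poly_subst g (\<Sum>n\<in>?L. ?s q n)"
    by (simp only: poly_subst_sum sum_product)
  finally show ?thesis by (simp only: cpoly_eq_sum_single)
qed

section \<open>Substitution into fractions\<close>

text \<open>The graph of \<open>rat_subst\<close>: it carries definedness together with the value,
  and can be derived along the structure of a formula without the definite description.\<close>

definition substitutes :: "('v::linorder \<Rightarrow> 'w::linorder ratfun) \<Rightarrow> 'v ratfun \<Rightarrow> 'w ratfun \<Rightarrow> bool" where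
  "substitutes g f h \<longleftrightarrow> (\<exists>p q. f = Fract p q \<and> poly_subst g q \<noteq> 0 \<and> h = poly_subst g p / poly_subst g q)"

text \<open>Equal fractions satisfy \<open>p * q' = p' * q\<close>, and the multiplicative
  \<open>poly_subst\<close> preserves this identity.\<close>

lemma substitutes_unique:
  assumes "substitutes g f h" "substitutes g f h'"
  shows "h = h'"
proof -
  obtain p q where 1: "f = Fract p q" "poly_subst g q \<noteq> 0" "h = poly_subst g p / poly_subst g q"
    using assms(1) unfolding substitutes_def by blast
  obtain p' q' where 2: "f = Fract p' q'" "poly_subst g q' \<noteq> 0" "h' = poly_subst g p' / poly_subst g q'"
    using assms(2) unfolding substitutes_def by blast
  have "q \<noteq> 0" "q' \<noteq> 0" using 1 2 by auto
  then have "p * q' = p' * q" using 1 2 by (simp add: eq_fract)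
  then have "poly_subst g p * poly_subst g q' = poly_subst g p' * poly_subst g q"
    by (metis poly_subst_mult)
  then show ?thesis using 1(2,3) 2(2,3) by (simp add: frac_eq_eq)
qed

lemma rat_subst_eqI: "substitutes g f h \<Longrightarrow> rat_subst g f = h"
  unfolding rat_subst_def substitutes_def[symmetric]
  by (blast intro: substitutes_unique)

lemma rat_subst_definedI: "substitutes g f h \<Longrightarrow> rat_subst_defined g f"
  unfolding rat_subst_defined_def substitutes_def by blast

lemma substitutes_cst: "substitutes g (cst c) (cst c)"
  unfolding substitutes_def
  by (rule exI[of _ "Poly_Mapping.single 0 c"], rule exI[of _ 1]) (simp add: cst_def poly_subst_single)

lemma substitutes_Var: "substitutes g (Var v) (g v)"
  unfolding substitutes_def
  by (rule exI[of _ "Poly_Mapping.single (Poly_Mapping.single v 1) 1"], rule exI[of _ 1])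
    (simp add: Var_def poly_subst_single)

lemma substitutes_add:
  assumes "substitutes g f h" "substitutes g f' h'"
  shows "substitutes g (f + f') (h + h')"
proof -
  obtain p q where 1: "f = Fract p q" "poly_subst g q \<noteq> 0" "h = poly_subst g p / poly_subst g q"
    using assms(1) unfolding substitutes_def by blast
  obtain p' q' where 2: "f' = Fract p' q'" "poly_subst g q' \<noteq> 0" "h' = poly_subst g p' / poly_subst g q'"
    using assms(2) unfolding substitutes_def by blast
  have "q \<noteq> 0" "q' \<noteq> 0" using 1 2 by auto
  with 1 2 show ?thesis unfolding substitutes_def
    by (intro exI[of _ "p * q' + p' * q"] exI[of _ "q * q'"])
      (simp add: poly_subst_add poly_subst_mult field_simps)
qed

lemma substitutes_mult:
  assumes "substitutes g f h" "substitutes g f' h'"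
  shows "substitutes g (f * f') (h * h')"
proof -
  obtain p q where 1: "f = Fract p q" "poly_subst g q \<noteq> 0" "h = poly_subst g p / poly_subst g q"
    using assms(1) unfolding substitutes_def by blast
  obtain p' q' where 2: "f' = Fract p' q'" "poly_subst g q' \<noteq> 0" "h' = poly_subst g p' / poly_subst g q'"
    using assms(2) unfolding substitutes_def by blast
  from 1 2 show ?thesis unfolding substitutes_def
    by (intro exI[of _ "p * p'"] exI[of _ "q * q'"]) (simp add: poly_subst_mult)
qed

lemma substitutes_inverse:
  assumes "substitutes g f h" "h \<noteq> 0"
  shows "substitutes g (inverse f) (inverse h)"
proof -
  obtain p q where 1: "f = Fract p q" "poly_subst g q \<noteq> 0" "h = poly_subst g p / poly_subst g q"
    using assms(1) unfolding substitutes_def by blast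
  with assms(2) show ?thesis unfolding substitutes_def
    by (intro exI[of _ q] exI[of _ p]) simp
qed

lemma substitutes_divide:
  assumes "substitutes g f h" "substitutes g f' h'" "h' \<noteq> 0"
  shows "substitutes g (f / f') (h / h')"
  using substitutes_mult[OF assms(1) substitutes_inverse[OF assms(2,3)]]
  by (simp add: divide_inverse)

lemma substitutes_1: "substitutes g 1 1"
  using substitutes_cst[of g 1] by simp

lemma substitutes_0: "substitutes g 0 0"
  using substitutes_cst[of g 0] by simp

lemma substitutes_power: "substitutes g f h \<Longrightarrow> substitutes g (f ^ n) (h ^ n)"
  by (induction n) (auto intro: substitutes_1 substitutes_mult)

lemmas substitutes_intros = substitutes_cst substitutes_Var substitutes_add substitutes_mult
  substitutes_divide substitutes_power

text \<open>Tests a rational function for nonvanishing by evaluating it at a suitable point.\<close>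

lemma substitutes_neq_0: "substitutes g f h \<Longrightarrow> h \<noteq> 0 \<Longrightarrow> f \<noteq> 0"
  using substitutes_unique[OF substitutes_0] by metis

lemma substitutes_sum:
  "(\<And>i. i \<in> A \<Longrightarrow> substitutes g (f i) (h i)) \<Longrightarrow> substitutes g (sum f A) (sum h A)"
  by (induction A rule: infinite_finite_induct) (auto intro: substitutes_0 substitutes_add)

lemma substitutes_prod:
  "(\<And>i. i \<in> A \<Longrightarrow> substitutes g (f i) (h i)) \<Longrightarrow> substitutes g (prod f A) (prod h A)"
  by (induction A rule: infinite_finite_induct) (auto intro: substitutes_1 substitutes_mult)

text \<open>\<open>poly_subst\<close> is built from constants, sums, products and powers, so
  substituting \<open>F\<close> and then \<open>G\<close> amounts to substituting the composite
  \<open>K\<close>.\<close>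

lemma substitutes_poly_subst:
  assumes "\<And>v. substitutes G (F v) (K v)"
  shows "substitutes G (poly_subst F p) (poly_subst K p)"
  unfolding poly_subst_def
  by (intro substitutes_sum substitutes_mult substitutes_prod substitutes_power substitutes_cst assms)

text \<open>The auxiliary facts move \<open>Fract _ 1\<close> outwards until the monomial expansion
  of \<open>p\<close> remains inside.\<close>

lemma poly_subst_Var: "poly_subst Var p = Fract p 1"
proof -
  have pow: "Fract x 1 ^ n = Fract (x ^ n) 1" for x :: "'a cpoly" and n
    by (induction n) (simp_all add: One_fract_def)
  have prod: "(\<Prod>i\<in>A. Fract (f i) 1) = Fract (prod f A) 1" for f :: "'a \<Rightarrow> 'a cpoly" and A
    by (induction A rule: infinite_finite_induct) (simp_all add: One_fract_def)
  have sum: "(\<Sum>i\<in>A. Fract (f i) 1) = Fract (sum f A) 1" for f :: "('a \<Rightarrow>\<^sub>0 nat) \<Rightarrow> 'a cpoly" and A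
    by (induction A rule: infinite_finite_induct) (simp_all add: Zero_fract_def)
  have single_pow: "Poly_Mapping.single (Poly_Mapping.single v (1::nat)) (1::complex) ^ n
     = Poly_Mapping.single (Poly_Mapping.single v n) 1" for v :: 'a and n
    by (induction n) (simp_all add: mult_single single_add[symmetric])
  have single_prod: "(\<Prod>v\<in>A. Poly_Mapping.single (m v) (1::complex)) = Poly_Mapping.single (sum m A) 1"
    for A and m :: "'a \<Rightarrow> ('a \<Rightarrow>\<^sub>0 nat)"
    by (induction A rule: infinite_finite_induct) (simp_all add: mult_single)
  have monom: "(\<Sum>v\<in>Poly_Mapping.keys m. Poly_Mapping.single v (Poly_Mapping.lookup m v)) = m" for m :: "'a \<Rightarrow>\<^sub>0 nat"
    by (rule poly_mapping_eqI) (simp add: lookup_sum lookup_single when_def in_keys_iff)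
  show ?thesis
    by (simp add: poly_subst_def Var_def cst_def pow prod sum single_pow[simplified] single_prod
        mult_single monom cpoly_eq_sum_single)
qed

section \<open>Dominant maps and the field homomorphisms they induce\<close>

text \<open>Injectivity of substitution on polynomials, the algebraic form of a Zariski-dense
  image.\<close>

definition dominant :: "('v::linorder \<Rightarrow> 'w::linorder ratfun) \<Rightarrow> bool" where
  "dominant F \<longleftrightarrow> (\<forall>p. poly_subst F p = 0 \<longrightarrow> p = 0)"

text \<open>A polynomial vanishing along \<open>F\<close> still vanishes after substituting
  \<open>G\<close>, which gives the polynomial back.\<close>

lemma dominant_left_inverse:
  assumes "\<And>v. substitutes G (F v) (Var v)"
  shows "dominant F"
  unfolding dominant_def
proof safe
  fix p assume "poly_subst F p = 0"
  then have "poly_subst Var p = 0"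
    using substitutes_poly_subst[of G F Var p] assms substitutes_unique[OF substitutes_0] by metis
  then show "p = 0" by (simp add: poly_subst_Var Zero_fract_def eq_fract)
qed

text \<open>No nonzero denominator vanishes along \<open>F\<close>, so \<open>rat_subst F\<close> is
  total and inherits its algebraic rules from \<open>substitutes\<close>.\<close>

lemma dominant_substitutes:
  assumes "dominant F"
  shows "substitutes F f (rat_subst F f)"
proof -
  obtain p q where "f = Fract p q" "q \<noteq> 0" by (cases f) auto
  moreover have "poly_subst F q \<noteq> 0" using assms \<open>q \<noteq> 0\<close> unfolding dominant_def by blast
  ultimately have "substitutes F f (poly_subst F p / poly_subst F q)"
    unfolding substitutes_def by blast
  then show ?thesis using rat_subst_eqI by metis
qed

lemma rat_subst_cst [simp]: "rat_subst F (cst c) = cst c"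
  by (rule rat_subst_eqI) (rule substitutes_cst)

lemma rat_subst_Var [simp]: "rat_subst F (Var v) = F v"
  by (rule rat_subst_eqI) (rule substitutes_Var)

context
  fixes F :: "'v::linorder \<Rightarrow> 'w::linorder ratfun"
  assumes F: "dominant F"
begin

lemma rat_subst_add: "rat_subst F (f + g) = rat_subst F f + rat_subst F g"
  by (intro rat_subst_eqI substitutes_add dominant_substitutes F)

lemma rat_subst_mult: "rat_subst F (f * g) = rat_subst F f * rat_subst F g"
  by (intro rat_subst_eqI substitutes_mult dominant_substitutes F)

lemma rat_subst_power: "rat_subst F (f ^ n) = rat_subst F f ^ n"
  by (intro rat_subst_eqI substitutes_power dominant_substitutes F)

lemma rat_subst_eq_0_iff: "rat_subst F f = 0 \<longleftrightarrow> f = 0"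
proof
  assume "rat_subst F f = 0"
  then obtain p q where "f = Fract p q" "poly_subst F q \<noteq> 0" "0 = poly_subst F p / poly_subst F q"
    using dominant_substitutes[OF F, of f] unfolding substitutes_def by auto
  then show "f = 0" using F unfolding dominant_def by (auto simp: fract_collapse)
qed (auto intro: rat_subst_eqI substitutes_0)

lemma rat_subst_divide: "rat_subst F (f / g) = rat_subst F f / rat_subst F g"
proof (cases "g = 0")
  case False
  then show ?thesis
    by (intro rat_subst_eqI substitutes_divide dominant_substitutes F) (simp add: rat_subst_eq_0_iff)
\<comment> \<open>For \<open>g = 0\<close> both sides are 0, since \<open>x / 0 = 0\<close>.\<close>
qed (simp add: rat_subst_eq_0_iff[THEN iffD2])

text \<open>A polynomial in \<open>rat_comp G F\<close> is a polynomial in \<open>G\<close> with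
  \<open>F\<close> substituted, and both substitutions are injective.\<close>

lemma dominant_rat_comp:
  assumes "dominant G"
  shows "dominant (rat_comp G F)"
  unfolding dominant_def
proof safe
  fix p assume "poly_subst (rat_comp G F) p = 0"
  moreover have "substitutes F (poly_subst G p) (poly_subst (rat_comp G F) p)"
    unfolding rat_comp_def by (intro substitutes_poly_subst dominant_substitutes F)
  ultimately have "rat_subst F (poly_subst G p) = 0"
    using rat_subst_eqI by metis
  then show "p = 0" using assms by (simp add: rat_subst_eq_0_iff dominant_def)
qed

lemma dominant_rat_comp_defined: "rat_comp_defined G F"
  unfolding rat_comp_defined_def by (blast intro: rat_subst_definedI dominant_substitutes F)

end

lemma dominant_Var: "dominant Var"
  by (rule dominant_left_inverse) (rule substitutes_Var)

text \<open>Every inner composite is dominant, so no definedness test fails and the optional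
  composition is an ordinary fold.\<close>

lemma dominant_rat_comps:
  assumes "\<forall>F\<in>set Fs. dominant F"
  shows "rat_comps Fs = Some (foldr rat_comp Fs Var) \<and> dominant (foldr rat_comp Fs Var)"
  using assms by (induction Fs) (auto simp: dominant_Var dominant_rat_comp dominant_rat_comp_defined)

lemmas dominant_rat_subst_simps = rat_subst_add rat_subst_mult rat_subst_power rat_subst_divide


section \<open>The tetrahedron map as an operation on states\<close>

text \<open>Over rational functions, \<open>s = Var\<close> gives the map itself and
  \<open>s = G\<close> its composite with a dominant \<open>G\<close>; the tetrahedron equation can
  then be computed over any field.\<close>

definition tetra_step ::
  "'i \<Rightarrow> 'i \<Rightarrow> 'i \<Rightarrow> 'k::field \<Rightarrow> 'k \<Rightarrow> 'k \<Rightarrow> (('i, 2) coord \<Rightarrow> 'k) \<Rightarrow> ('i, 2) coord \<Rightarrow> 'k" where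
  "tetra_step i j k a b c s =
     (let x = s (Coord i 1); x' = s (Coord i 2); y = s (Coord j 1); y' = s (Coord j 2);
          z = s (Coord k 1); z' = s (Coord k 2); D = a * y * y' + b * x^2 * x' * z'
      in s(Coord i 1 := y, Coord i 2 := a * x^2 * x' * y' / (D * z),
           Coord j 1 := x, Coord j 2 := b * x' * z * z' / (a * c),
           Coord k 1 := y * z / x, Coord k 2 := D / (a * x * x' * y)))"

text \<open>\<open>K\<close> stands for the forward denominator: at the recovered point
  \<open>D = a * u * K / w\<close>.\<close>

definition tetra_inv_step ::
  "'i \<Rightarrow> 'i \<Rightarrow> 'i \<Rightarrow> 'k::field \<Rightarrow> 'k \<Rightarrow> 'k \<Rightarrow> (('i, 2) coord \<Rightarrow> 'k) \<Rightarrow> ('i, 2) coord \<Rightarrow> 'k" where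
  "tetra_inv_step i j k a b c s =
     (let u = s (Coord i 1); u' = s (Coord i 2); v = s (Coord j 1); v' = s (Coord j 2);
          w = s (Coord k 1); w' = s (Coord k 2); K = u' * w^2 * w' + c * v * v'
      in s(Coord i 1 := v, Coord i 2 := K / (v * w * w'),
           Coord j 1 := u, Coord j 2 := u' * w * w',
           Coord k 1 := v * w / u, Coord k 2 := a * c * u * v' * w' / (b * K)))"

lemma exhaust_2: "(t :: 2) = 1 \<or> t = 2"
proof -
  have "card {1, 2 :: 2} = CARD(2)" by simp
  then have "{1, 2 :: 2} = UNIV" by (simp only: card_eq_UNIV_imp_eq_UNIV finite)
  then show ?thesis by blast
qed

lemma exhaust_3: "(t :: 3) = 1 \<or> t = 2 \<or> t = 3"
proof -
  have "card {1, 2, 3 :: 3} = CARD(3)" by simp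
  then have "{1, 2, 3 :: 3} = UNIV" by (simp only: card_eq_UNIV_imp_eq_UNIV finite)
  then show ?thesis by blast
qed

lemma exhaust_6: "(t :: 6) = 1 \<or> t = 2 \<or> t = 3 \<or> t = 4 \<or> t = 5 \<or> t = 6"
proof -
  have "card {1, 2, 3, 4, 5, 6 :: 6} = CARD(6)" by simp
  then have "{1, 2, 3, 4, 5, 6 :: 6} = UNIV" by (simp only: card_eq_UNIV_imp_eq_UNIV finite)
  then show ?thesis by blast
qed

lemma coord2_cases:
  fixes q :: "('i, 2) coord"
  obtains l where "q = Coord l 1" | l where "q = Coord l 2"
  using exhaust_2 by (metis coord.exhaust)

section \<open>The two steps are mutually inverse\<close>

lemma tetra_step_inv_step:
  assumes "distinct [i, j, k]" "a \<noteq> 0" "b \<noteq> 0" "c \<noteq> 0" and nz: "\<And>q. s q \<noteq> 0"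
    and K: "s (Coord i 2) * s (Coord k 1)^2 * s (Coord k 2) + c * s (Coord j 1) * s (Coord j 2) \<noteq> 0"
  shows "tetra_step i j k a b c (tetra_inv_step i j k a b c s) = s"
proof
  fix q
  define K where "K = s (Coord i 2) * s (Coord k 1)^2 * s (Coord k 2) + c * s (Coord j 1) * s (Coord j 2)"
  let ?r = "tetra_inv_step i j k a b c s"
  have r: "?r (Coord i 1) = s (Coord j 1)" "?r (Coord i 2) = K / (s (Coord j 1) * s (Coord k 1) * s (Coord k 2))"
    "?r (Coord j 1) = s (Coord i 1)" "?r (Coord j 2) = s (Coord i 2) * s (Coord k 1) * s (Coord k 2)"
    "?r (Coord k 1) = s (Coord j 1) * s (Coord k 1) / s (Coord i 1)"
    "?r (Coord k 2) = a * c * s (Coord i 1) * s (Coord j 2) * s (Coord k 2) / (b * K)"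
    using assms(1) by (simp_all add: tetra_inv_step_def K_def Let_def)
  have other: "?r (Coord l m) = s (Coord l m)" if "l \<notin> {i, j, k}" for l m
    using that by (simp add: tetra_inv_step_def Let_def)
  have K0: "K \<noteq> 0" using K by (simp add: K_def)
  have D: "a * ?r (Coord j 1) * ?r (Coord j 2) + b * ?r (Coord i 1)^2 * ?r (Coord i 2) * ?r (Coord k 2)
      = a * s (Coord i 1) * K / s (Coord k 1)"
    unfolding r using assms(2-4) nz K0
    \<comment> \<open>\<open>K\<close> stays folded while denominators are cleared, so that
      \<open>K0\<close> applies; it is expanded only for the remaining polynomial identity.\<close>
    by (simp add: field_simps power2_eq_square) (simp add: K_def algebra_simps power2_eq_square)
  show "tetra_step i j k a b c ?r q = s q"
    unfolding tetra_step_def Let_def D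
    using assms(1-4) nz K0
    by (cases q rule: coord2_cases) (auto simp: r other field_simps power2_eq_square)
qed

text \<open>At the image, \<open>K\<close> is
  \<open>s (Coord k 1) * D / (a * s (Coord i 1))\<close>, so it inherits nonvanishing from
  \<open>D\<close>. The first two conclusions are what \<open>substitutes_tetra_inv_step\<close>
  asks for.\<close>

lemma tetra_inv_step_step:
  assumes "distinct [i, j, k]" "a \<noteq> 0" "b \<noteq> 0" "c \<noteq> 0" and nz: "\<And>q. s q \<noteq> 0"
    and D: "a * s (Coord j 1) * s (Coord j 2) + b * s (Coord i 1)^2 * s (Coord i 2) * s (Coord k 2) \<noteq> 0"
  defines "r \<equiv> tetra_step i j k a b c s"
  shows "r (Coord i 2) * r (Coord k 1)^2 * r (Coord k 2) + c * r (Coord j 1) * r (Coord j 2) \<noteq> 0"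
    and "r q \<noteq> 0"
    and "tetra_inv_step i j k a b c r q = s q"
proof -
  define D where "D = a * s (Coord j 1) * s (Coord j 2) + b * s (Coord i 1)^2 * s (Coord i 2) * s (Coord k 2)"
  have r: "r (Coord i 1) = s (Coord j 1)"
    "r (Coord i 2) = a * s (Coord i 1)^2 * s (Coord i 2) * s (Coord j 2) / (D * s (Coord k 1))"
    "r (Coord j 1) = s (Coord i 1)" "r (Coord j 2) = b * s (Coord i 2) * s (Coord k 1) * s (Coord k 2) / (a * c)"
    "r (Coord k 1) = s (Coord j 1) * s (Coord k 1) / s (Coord i 1)"
    "r (Coord k 2) = D / (a * s (Coord i 1) * s (Coord i 2) * s (Coord j 1))"
    using assms(1) by (simp_all add: r_def tetra_step_def D_def Let_def)
  have other: "r (Coord l m) = s (Coord l m)" if "l \<notin> {i, j, k}" for l m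
    using that by (simp add: r_def tetra_step_def Let_def)
  have D0: "D \<noteq> 0" using D by (simp add: D_def)
  have K: "r (Coord i 2) * r (Coord k 1)^2 * r (Coord k 2) + c * r (Coord j 1) * r (Coord j 2)
      = s (Coord k 1) * D / (a * s (Coord i 1))"
    unfolding r using assms(2-4) nz D0
    by (simp add: field_simps power2_eq_square) (simp add: D_def algebra_simps power2_eq_square)
  then show "r (Coord i 2) * r (Coord k 1)^2 * r (Coord k 2) + c * r (Coord j 1) * r (Coord j 2) \<noteq> 0"
    using D0 nz assms(2) by simp
  show "r q \<noteq> 0"
    using assms(1-4) nz D0
    by (cases q rule: coord2_cases)
      (metis (no_types) r other insertE empty_iff
        divide_eq_0_iff mult_eq_0_iff power_eq_0_iff)+
  show "tetra_inv_step i j k a b c r q = s q"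
    unfolding tetra_inv_step_def Let_def K
    using assms(1-4) nz D0
    by (cases q rule: coord2_cases) (auto simp: r other field_simps power2_eq_square)
qed

section \<open>From states to rational maps\<close>

text \<open>Serves before any dominance is known: the denominators are products of \<open>b\<close>,
  coordinates of \<open>G\<close> and the quantity \<open>K\<close>.\<close>

lemma substitutes_tetra_inv_step:
  assumes "b \<noteq> 0" "\<And>q. G q \<noteq> 0"
    and "G (Coord i 2) * G (Coord k 1)^2 * G (Coord k 2) + cst c * G (Coord j 1) * G (Coord j 2) \<noteq> 0"
  shows "substitutes G (tetra_inv_step i j k (cst a) (cst b) (cst c) Var q)
    (tetra_inv_step i j k (cst a) (cst b) (cst c) G q)"
  using assms unfolding tetra_inv_step_def Let_def
  by (auto intro!: substitutes_intros)

text \<open>Substituting a dominant \<open>G\<close> commutes with the field operations, so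
  composing maps becomes applying the step to the state \<open>G\<close>.\<close>

lemma rat_comp_tetra_step:
  assumes "dominant G"
  shows "rat_comp (tetra_step i j k (cst a) (cst b) (cst c) Var) G
    = tetra_step i j k (cst a) (cst b) (cst c) G"
  by (rule ext) (simp add: rat_comp_def tetra_step_def Let_def dominant_rat_subst_simps[OF assms])

lemma rat_comp_tetra_inv_step:
  assumes "dominant G"
  shows "rat_comp (tetra_inv_step i j k (cst a) (cst b) (cst c) Var) G
    = tetra_inv_step i j k (cst a) (cst b) (cst c) G"
  by (rule ext) (simp add: rat_comp_def tetra_inv_step_def Let_def dominant_rat_subst_simps[OF assms])

lemma dominant_neq_0: "dominant F \<Longrightarrow> F v \<noteq> 0"
  using rat_subst_eq_0_iff[of F "Var v"] by simp

lemma tetra_denominator_neq_0: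
  assumes "distinct [i, j, k]" "a \<noteq> 0"
  shows "cst a * Var (Coord j 1) * Var (Coord j 2)
    + cst b * Var (Coord i 1)^2 * Var (Coord i 2) * Var (Coord k 2) \<noteq> (0 :: ('i::linorder, 2) coord ratfun)"
proof -
  \<comment> \<open>At this point the second term vanishes and the first becomes
    \<open>cst a\<close>.\<close>
  define g :: "('i, 2) coord \<Rightarrow> ('i, 2) coord ratfun" where "g = (\<lambda>q. if q = Coord k 2 then 0 else 1)"
  have "substitutes g (cst a * Var (Coord j 1) * Var (Coord j 2)
      + cst b * Var (Coord i 1)^2 * Var (Coord i 2) * Var (Coord k 2))
    (cst a * g (Coord j 1) * g (Coord j 2) + cst b * g (Coord i 1) ^2 * g (Coord i 2) * g (Coord k 2))"
    by (intro substitutes_intros)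
  moreover have "cst a * g (Coord j 1) * g (Coord j 2) + cst b * g (Coord i 1) ^2 * g (Coord i 2) * g (Coord k 2) \<noteq> 0"
    using assms by (simp add: g_def)
  ultimately show ?thesis by (rule substitutes_neq_0)
qed

text \<open>A bootstrap: direct computation gives \<open>?S (?T Var) = Var\<close>, which makes
  \<open>?S Var\<close> dominant; that yields the nonvanishing needed for
  \<open>?T (?S Var) = Var\<close>, and hence dominance of \<open>?T Var\<close>.\<close>

lemma
  fixes i j k :: "'i::linorder"
  assumes "distinct [i, j, k]" "a \<noteq> 0" "b \<noteq> 0" "c \<noteq> 0"
  shows dominant_tetra_step: "dominant (tetra_step i j k (cst a) (cst b) (cst c) Var)"
    and dominant_tetra_inv_step: "dominant (tetra_inv_step i j k (cst a) (cst b) (cst c) Var)"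
    and tetra_step_inv_step_Var: "tetra_step i j k (cst a) (cst b) (cst c)
      (tetra_inv_step i j k (cst a) (cst b) (cst c) Var) = Var"
    and tetra_inv_step_step_Var: "tetra_inv_step i j k (cst a) (cst b) (cst c)
      (tetra_step i j k (cst a) (cst b) (cst c) Var) = Var"
proof -
  let ?T = "tetra_step i j k (cst a) (cst b) (cst c)"
  let ?S = "tetra_inv_step i j k (cst a) (cst b) (cst c)"
  note D = tetra_denominator_neq_0[OF assms(1,2), of b]
  note ST = tetra_inv_step_step[of i j k "cst a" "cst b" "cst c" Var, OF assms(1) _ _ _ _ D]
  show ST_Var: "?S (?T Var) = Var"
    using ST(3) assms by auto
  have "substitutes (?T Var) (?S Var q) (?S (?T Var) q)" for q
    using assms by (intro substitutes_tetra_inv_step ST) simp_all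
  then show S: "dominant (?S Var)"
    unfolding ST_Var by (rule dominant_left_inverse)
  \<comment> \<open>The numerator of this coordinate is the \<open>K\<close> of the inverse
    step.\<close>
  have "?S Var (Coord i 2) \<noteq> 0" by (rule dominant_neq_0[OF S])
  then have "Var (Coord i 2) * Var (Coord k 1)^2 * Var (Coord k 2)
      + cst c * Var (Coord j 1) * Var (Coord j 2) \<noteq> (0 :: ('i, 2) coord ratfun)"
    using assms(1) by (auto simp: tetra_inv_step_def Let_def)
  then show TS_Var: "?T (?S Var) = Var"
    using assms by (intro tetra_step_inv_step) simp_all
  have "substitutes (?S Var) (?T Var q) (Var q)" for q
    using dominant_substitutes[OF S, of "?T Var q"] rat_comp_tetra_step[OF S, of i j k a b c]
    by (simp add: TS_Var rat_comp_def fun_eq_iff)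
  then show "dominant (?T Var)" by (rule dominant_left_inverse)
qed

lemma tetra_map_eq_tetra_step: "tetra_map a b c = tetra_step 1 2 3 (cst a) (cst b) (cst c) Var"
proof
  fix q :: coord6
  obtain l m where q: "q = Coord l m" by (cases q)
  show "tetra_map a b c q = tetra_step 1 2 3 (cst a) (cst b) (cst c) Var q"
    using exhaust_3[of l] exhaust_2[of m]
    by (elim disjE) (simp_all add: q tetra_map_def six_tuple_def tetra_step_def Let_def)
qed

lemma act_on_tetra_map:
  fixes i j k :: "'i::linorder"
  assumes "distinct [i, j, k]"
  shows "act_on i j k (tetra_map a b c) = tetra_step i j k (cst a) (cst b) (cst c) Var"
proof -
  let ?F = "\<lambda>p::coord6. Var (Coord (place i j k (factor p)) (component p)) :: ('i, 2) coord ratfun"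
  \<comment> \<open>A left inverse of the renaming; labels other than \<open>i\<close> and
    \<open>j\<close> all go to 3, which is right for \<open>k\<close> and immaterial
    elsewhere.\<close>
  define G :: "('i, 2) coord \<Rightarrow> coord6 ratfun" where
    "G = (\<lambda>p. Var (Coord (if factor p = i then 1 else if factor p = j then 2 else 3) (component p)))"
  have "substitutes G (?F v) (Var v)" for v
  proof -
    obtain l m where v: "v = Coord l m" by (cases v)
    have "G (Coord (place i j k (factor v)) (component v)) = Var v"
      using exhaust_3[of l] assms by (auto simp: v G_def place_def)
    then show ?thesis using substitutes_Var by metis
  qed
  then have dom: "dominant ?F" by (rule dominant_left_inverse)
  show ?thesis
  proof
    fix q :: "('i, 2) coord"
    show "act_on i j k (tetra_map a b c) q = tetra_step i j k (cst a) (cst b) (cst c) Var q"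
      using assms
      by (cases q rule: coord2_cases)
        (auto simp: act_on_def Let_def tetra_map_def six_tuple_def tetra_step_def place_def
          dominant_rat_subst_simps[OF dom[unfolded place_def]])
  qed
qed

section \<open>The tetrahedron equation over a field\<close>

text \<open>\<open>D\<close> is a separate variable so that each later denominator can enter in
  factored form.\<close>

lemma tetra_step_apply:
  assumes "distinct [i, j, k]"
    and "D = a * s (Coord j 1) * s (Coord j 2) + b * s (Coord i 1)^2 * s (Coord i 2) * s (Coord k 2)"
  shows "tetra_step i j k a b c s (Coord i 1) = s (Coord j 1)"
    "tetra_step i j k a b c s (Coord i 2) = a * s (Coord i 1)^2 * s (Coord i 2) * s (Coord j 2) / (D * s (Coord k 1))"
    "tetra_step i j k a b c s (Coord j 1) = s (Coord i 1)"
    "tetra_step i j k a b c s (Coord j 2) = b * s (Coord i 2) * s (Coord k 1) * s (Coord k 2) / (a * c)"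
    "tetra_step i j k a b c s (Coord k 1) = s (Coord j 1) * s (Coord k 1) / s (Coord i 1)"
    "tetra_step i j k a b c s (Coord k 2) = D / (a * s (Coord i 1) * s (Coord i 2) * s (Coord j 1))"
    "l \<notin> {i, j, k} \<Longrightarrow> tetra_step i j k a b c s (Coord l m) = s (Coord l m)"
  using assms by (auto simp: tetra_step_def Let_def)

text \<open>Each step puts its denominator into the numerator of the coordinate
  \<open>Coord k 2\<close>, so nonvanishing of the intermediate states keeps the denominators away
  from 0.\<close>

lemma tetra_step_functional_equation:
  fixes a b c d e f :: "'k::field" and s :: "(6, 2) coord \<Rightarrow> 'k"
  assumes params: "a \<noteq> 0" "b \<noteq> 0" "c \<noteq> 0" "d \<noteq> 0" "e \<noteq> 0" "f \<noteq> 0"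
    and s: "\<And>q. s q \<noteq> 0"
  defines "r1 \<equiv> tetra_step 1 2 3 a b c s"
  defines "r2 \<equiv> tetra_step 1 4 5 a d e r1"
  defines "r3 \<equiv> tetra_step 2 4 6 b d f r2"
  defines "r4 \<equiv> tetra_step 3 5 6 c e f r3"
  defines "l1 \<equiv> tetra_step 3 5 6 c e f s"
  defines "l2 \<equiv> tetra_step 2 4 6 b d f l1"
  defines "l3 \<equiv> tetra_step 1 4 5 a d e l2"
  defines "l4 \<equiv> tetra_step 1 2 3 a b c l3"
  assumes r1: "\<And>q. r1 q \<noteq> 0" and r2: "\<And>q. r2 q \<noteq> 0" and r3: "\<And>q. r3 q \<noteq> 0"
    and l1: "\<And>q. l1 q \<noteq> 0" and l2: "\<And>q. l2 q \<noteq> 0" and l3: "\<And>q. l3 q \<noteq> 0"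
  shows "l4 = r4"
proof -
  define p where "p i = s (Coord i 1)" for i
  define q where "q i = s (Coord i 2)" for i
  have s_eq: "s (Coord i 1) = p i" "s (Coord i 2) = q i" for i
    by (simp_all add: p_def q_def)
  have pq: "p i \<noteq> 0" "q i \<noteq> 0" for i
    using s by (simp_all add: p_def q_def)
  \<comment> \<open>Up to monomial factors, these are the denominators occurring along the two composites: \<open>A, B, C, A F\<close>
    on the right-hand side and \<open>A', F, C, A' B\<close> on the left-hand side. The factorizations \<open>D4\<close> and \<open>E4\<close> make
    the results agree.\<close>
  define A where "A = a * p 2 * q 2 + b * p 1^2 * q 1 * q 3"
  define A' where "A' = c * p 5 * q 5 + e * p 3^2 * q 3 * q 6"
  define B where "B = A * p 3 * p 4 * q 4 + d * p 1^2 * p 2^2 * q 1 * q 2 * q 5"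
  define C where "C = a * c * p 2 * q 2 * p 5 * q 5 + e * A * p 3^2 * q 3 * q 6"
  define F where "F = b * c * p 3 * p 4 * p 5 * q 3 * q 4 + d * p 2^2 * q 2 * A'"

  have dist: "distinct [1, 2, 3 :: 6]" "distinct [1, 4, 5 :: 6]" "distinct [2, 4, 6 :: 6]" "distinct [3, 5, 6 :: 6]"
    by simp_all
  have "tetra_step 1 2 3 a b c s (Coord 3 2) = A / (a * p 1 * q 1 * p 2)"
    by (subst tetra_step_apply(6)[where D = A]) (simp_all add: s_eq A_def)
  then have A0: "A \<noteq> 0" using r1[of "Coord 3 2"] by (auto simp: r1_def)
  note r1_eq = tetra_step_apply[where i = 1 and j = 2 and k = 3 and D = A and a = a and s = s and b = b and c = c,
      unfolded s_eq, folded r1_def, OF dist(1) A_def]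
  have D2: "a * B / (A * p 3) = a * r1 (Coord 4 1) * r1 (Coord 4 2) + d * r1 (Coord 1 1)^2 * r1 (Coord 1 2) * r1 (Coord 5 2)"
    using params pq A0 by (simp add: r1_eq s_eq field_simps) (simp add: B_def field_simps power2_eq_square)
  note r2_eq = tetra_step_apply[where i = 1 and j = 4 and k = 5 and a = a and s = r1 and b = d and c = e,
      folded r2_def, OF dist(2) D2]
  have B0: "B \<noteq> 0" using r2[of "Coord 5 2"] r2_eq(6) by (auto split: if_splits)
  have D3: "b * d * p 1^2 * q 1 * C / (A * p 3 * e * a * c)
     = b * r2 (Coord 4 1) * r2 (Coord 4 2) + d * r2 (Coord 2 1)^2 * r2 (Coord 2 2) * r2 (Coord 6 2)"
    using params pq A0 B0 by (simp add: r2_eq r1_eq s_eq field_simps)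
      (simp add: C_def field_simps power2_eq_square)
  note r3_eq = tetra_step_apply[where i = 2 and j = 4 and k = 6 and a = b and s = r2 and b = d and c = f,
      folded r3_def, OF dist(3) D3]
  have C0: "C \<noteq> 0" using r3[of "Coord 6 2"] r3_eq(6) by (auto split: if_splits)
  \<comment> \<open>Up to monomials,
    \<open>b * c * p 5 * q 3 * B + d * p 2^2 * q 2 * C = A * F\<close>.\<close>
  have D4: "A * F / (a * b * p 1^2 * p 2^2 * q 1 * q 2 * q 3)
     = c * r3 (Coord 5 1) * r3 (Coord 5 2) + e * r3 (Coord 3 1)^2 * r3 (Coord 3 2) * r3 (Coord 6 2)"
    using params pq A0 B0 C0
    by (simp add: r3_eq r2_eq r1_eq s_eq field_simps power2_eq_square)
      (simp add: A_def A'_def B_def C_def F_def field_simps power2_eq_square)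
  note r4_eq = tetra_step_apply[where i = 3 and j = 5 and k = 6 and a = c and s = r3 and b = e and c = f,
      folded r4_def, OF dist(4) D4]

  note l1_eq = tetra_step_apply[where i = 3 and j = 5 and k = 6 and D = A' and a = c and s = s and b = e and c = f,
      unfolded s_eq, folded l1_def, OF dist(4) A'_def]
  have A'0: "A' \<noteq> 0" using l1[of "Coord 6 2"] l1_eq(6) by (auto split: if_splits)
  have E2: "F / (c * p 3 * p 5 * q 3) = b * l1 (Coord 4 1) * l1 (Coord 4 2) + d * l1 (Coord 2 1)^2 * l1 (Coord 2 2) * l1 (Coord 6 2)"
    using params pq A'0 by (simp add: l1_eq s_eq field_simps) (simp add: F_def field_simps power2_eq_square)
  note l2_eq = tetra_step_apply[where i = 2 and j = 4 and k = 6 and a = b and s = l1 and b = d and c = f,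
      folded l2_def, OF dist(3) E2]
  have F0: "F \<noteq> 0" using l2[of "Coord 6 2"] l2_eq(6) by (auto split: if_splits)
  \<comment> \<open>The same \<open>C\<close> as on the other side: \<open>C = a * p 2 * q 2 * A' +
    b * e * p 1^2 * p 3^2 * q 1 * q 3^2 * q 6\<close>.\<close>
  have E3: "d * p 6 * C / (b * c * f * p 3^2 * q 3)
     = a * l2 (Coord 4 1) * l2 (Coord 4 2) + d * l2 (Coord 1 1)^2 * l2 (Coord 1 2) * l2 (Coord 5 2)"
    using params pq A'0 F0 by (simp add: l2_eq l1_eq s_eq field_simps power2_eq_square)
      (simp add: C_def A_def A'_def field_simps power2_eq_square)
  note l3_eq = tetra_step_apply[where i = 1 and j = 4 and k = 5 and a = a and s = l2 and b = d and c = e,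
      folded l3_def, OF dist(2) E3]
  \<comment> \<open>Up to monomials,
    \<open>p 3 * p 4 * q 4 * C + p 1^2 * q 1 * q 5 * F = A' * B\<close>.\<close>
  have E4: "a * b * c * p 2^2 * q 2 * q 3 * p 3 * A' * B / (p 6 * F * C)
     = a * l3 (Coord 2 1) * l3 (Coord 2 2) + b * l3 (Coord 1 1)^2 * l3 (Coord 1 2) * l3 (Coord 3 2)"
    using params pq A'0 F0 C0
    by (simp add: l3_eq l2_eq l1_eq s_eq field_simps power2_eq_square)
      (simp add: A_def A'_def B_def C_def F_def field_simps power2_eq_square)
  note l4_eq = tetra_step_apply[where i = 1 and j = 2 and k = 3 and a = a and s = l3 and b = b and c = c,
      folded l4_def, OF dist(1) E4]
  show ?thesis
  proof
    fix x :: "(6, 2) coord"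
    obtain l m where x: "x = Coord l m" by (cases x)
    \<comment> \<open>With \<open>A\<close>, \<open>A'\<close>, \<open>B\<close>, \<open>C\<close>,
      \<open>F\<close> folded, both sides are quotients of monomials in all twelve
      coordinates.\<close>
    show "l4 x = r4 x"
      using exhaust_6[of l] exhaust_2[of m] params pq A0 A'0 B0 C0 F0
      by (elim disjE)
        (simp_all add: x r4_eq r3_eq r2_eq r1_eq l4_eq l3_eq l2_eq l1_eq s_eq,
          simp_all add: field_simps power2_eq_square)
  qed
qed


section \<open>Properties of the map\<close>

text \<open>On \<open>x1\<close>, \<open>y1\<close>, \<open>z1\<close> alone the map is an
  involution, so the contradiction is drawn from a second component, that of
  \<open>x2\<close>.\<close>

lemma noninvolutive_tetra_map:
  assumes "a \<noteq> 0" "b \<noteq> 0" "c \<noteq> 0"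
  shows "noninvolutive (tetra_map a b c)"
proof -
  have dist: "distinct [1, 2, 3 :: 3]" by simp
  let ?T = "tetra_step 1 2 3 (cst a) (cst b) (cst c) :: _ \<Rightarrow> coord6 \<Rightarrow> coord6 ratfun"
  note dom = dominant_tetra_step[OF dist assms]
  have "?T (?T Var) \<noteq> Var"
  proof
    assume eq: "?T (?T Var) = Var"
    define D where "D = cst a * y1 * y2 + cst b * x1^2 * x2 * z2"
    have D0: "D \<noteq> 0"
      unfolding D_def by (rule tetra_denominator_neq_0[OF dist assms(1)])
    note T_eq = tetra_step_apply(1-6)[OF dist D_def]
    \<comment> \<open>The denominator of the second application up to the factor
      \<open>cst b * x1 / (cst c * z1)\<close>; \<open>D\<close> cancels there.\<close>
    define K where "K = x2 * z1^2 * z2 + cst c * y1 * y2"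
    have D': "cst b * x1 * K / (cst c * z1)
      = cst a * ?T Var (Coord 2 1) * ?T Var (Coord 2 2)
        + cst b * ?T Var (Coord 1 1)^2 * ?T Var (Coord 1 2) * ?T Var (Coord 3 2)"
      unfolding T_eq using D0 assms by (simp add: K_def field_simps power2_eq_square)
    have x2_eq: "x2 = cst a * ?T Var (Coord 1 1)^2 * ?T Var (Coord 1 2) * ?T Var (Coord 2 2)
        / (cst b * x1 * K / (cst c * z1) * ?T Var (Coord 3 1))"
      using tetra_step_apply(2)[OF dist D', of "cst c"] by (simp add: eq)
    \<comment> \<open>If \<open>K\<close> were 0, the right-hand side of \<open>x2_eq\<close> would
      be a division by 0, hence 0.\<close>
    then have "K \<noteq> 0" using Var_neq_0[of "Coord 1 2 :: coord6"] by auto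
    with x2_eq D0 assms have "D * K = cst a * y1 * x1^2 * x2 * y2 * z2"
      unfolding T_eq by (simp add: field_simps power2_eq_square)
    \<comment> \<open>At \<open>z2 = 0\<close>, with all other variables 1, the two sides become
      \<open>cst a * cst c\<close> and 0.\<close>
    moreover define g :: "coord6 \<Rightarrow> coord6 ratfun" where "g = (\<lambda>q. if q = Coord 3 2 then 0 else 1)"
    let ?V = "\<lambda>i j. g (Coord i j)"
    have "substitutes g (D * K) ((cst a * ?V 2 1 * ?V 2 2 + cst b * ?V 1 1 ^2 * ?V 1 2 * ?V 3 2)
        * (?V 1 2 * ?V 3 1 ^2 * ?V 3 2 + cst c * ?V 2 1 * ?V 2 2))"
      unfolding D_def K_def by (intro substitutes_intros)
    moreover have "substitutes g (cst a * y1 * x1^2 * x2 * y2 * z2)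
        (cst a * ?V 2 1 * ?V 1 1 ^2 * ?V 1 2 * ?V 2 2 * ?V 3 2)"
      by (intro substitutes_intros)
    ultimately have "(cst a * ?V 2 1 * ?V 2 2 + cst b * ?V 1 1 ^2 * ?V 1 2 * ?V 3 2)
        * (?V 1 2 * ?V 3 1 ^2 * ?V 3 2 + cst c * ?V 2 1 * ?V 2 2)
      = cst a * ?V 2 1 * ?V 1 1 ^2 * ?V 1 2 * ?V 2 2 * ?V 3 2"
      by (metis substitutes_unique)
    then show False using assms by (simp add: g_def)
  qed
  then show ?thesis
    by (simp add: noninvolutive_def tetra_map_eq_tetra_step dominant_rat_comp_defined[OF dom]
        rat_comp_tetra_step[OF dom])
qed

lemma birational_tetra_map:
  assumes "a \<noteq> 0" "b \<noteq> 0" "c \<noteq> 0"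
  shows "birational (tetra_map a b c)"
proof -
  have dist: "distinct [1, 2, 3 :: 3]" by simp
  note T = dominant_tetra_step[OF dist assms] and S = dominant_tetra_inv_step[OF dist assms]
  show ?thesis
    unfolding birational_def tetra_map_eq_tetra_step
    by (rule exI[of _ "tetra_inv_step 1 2 3 (cst a) (cst b) (cst c) Var"])
      (simp add: dominant_rat_comp_defined T S rat_comp_tetra_step rat_comp_tetra_inv_step
        tetra_step_inv_step_Var[OF dist assms] tetra_inv_step_step_Var[OF dist assms])
qed

lemma rat_invariant_tetra_map:
  assumes "a \<noteq> 0" "b \<noteq> 0" "c \<noteq> 0"
  shows "rat_invariant (tetra_map a b c) (x1 + y1)"
    and "rat_invariant (tetra_map a b c) (y1 * z1)"
    and "rat_invariant (tetra_map a b c) (x1 / z1)"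
proof -
  have dist: "distinct [1, 2, 3 :: 3]" by simp
  note T = dominant_tetra_step[OF dist assms, folded tetra_map_eq_tetra_step]
  have "rat_subst_defined (tetra_map a b c) I" for I
    by (rule rat_subst_definedI[OF dominant_substitutes[OF T]])
  then show "rat_invariant (tetra_map a b c) (x1 + y1)"
    "rat_invariant (tetra_map a b c) (y1 * z1)"
    "rat_invariant (tetra_map a b c) (x1 / z1)"
    by (simp_all add: rat_invariant_def dominant_rat_subst_simps[OF T])
      (simp_all add: tetra_map_def six_tuple_def)
qed

lemma parametric_tetrahedron_tetra_map: "parametric_tetrahedron_map (- {0}) tetra_map"
proof -
  have tetrahedron: "rat_comps [T123, T145, T246, T356] \<noteq> None
      \<and> rat_comps [T123, T145, T246, T356] = rat_comps [T356, T246, T145, T123]"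
    if nz: "a \<noteq> 0" "b \<noteq> 0" "c \<noteq> 0" "d \<noteq> 0" "e \<noteq> 0" "f \<noteq> 0"
      and T_def: "T123 = act_on (1::6) 2 3 (tetra_map a b c)" "T145 = act_on (1::6) 4 5 (tetra_map a d e)"
        "T246 = act_on (2::6) 4 6 (tetra_map b d f)" "T356 = act_on (3::6) 5 6 (tetra_map c e f)"
    for a b c d e f :: complex and T123 T145 T246 T356
  proof -
    have T: "T123 = tetra_step 1 2 3 (cst a) (cst b) (cst c) Var"
      "T145 = tetra_step 1 4 5 (cst a) (cst d) (cst e) Var"
      "T246 = tetra_step 2 4 6 (cst b) (cst d) (cst f) Var"
      "T356 = tetra_step 3 5 6 (cst c) (cst e) (cst f) Var"
      unfolding T_def by (simp_all add: act_on_tetra_map)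
    have dom: "dominant T123" "dominant T145" "dominant T246" "dominant T356"
      unfolding T using nz by (simp_all add: dominant_tetra_step)
    have comp: "rat_comp T123 G = tetra_step 1 2 3 (cst a) (cst b) (cst c) G"
      "rat_comp T145 G = tetra_step 1 4 5 (cst a) (cst d) (cst e) G"
      "rat_comp T246 G = tetra_step 2 4 6 (cst b) (cst d) (cst f) G"
      "rat_comp T356 G = tetra_step 3 5 6 (cst c) (cst e) (cst f) G"
      if "dominant G" for G :: "((6, 2) coord, (6, 2) coord) ratmap"
      unfolding T using that by (simp_all add: rat_comp_tetra_step)
    \<comment> \<open>\<open>comp\<close> needs a dominant inner composite at every stage; this also
      makes all intermediate coordinates nonzero.\<close>
    have dom_comp: "dominant (tetra_step 1 2 3 (cst a) (cst b) (cst c) G)"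
      "dominant (tetra_step 1 4 5 (cst a) (cst d) (cst e) G)"
      "dominant (tetra_step 2 4 6 (cst b) (cst d) (cst f) G)"
      "dominant (tetra_step 3 5 6 (cst c) (cst e) (cst f) G)"
      if "dominant G" for G :: "((6, 2) coord, (6, 2) coord) ratmap"
      using dominant_rat_comp[OF that dom(1)] dominant_rat_comp[OF that dom(2)]
        dominant_rat_comp[OF that dom(3)] dominant_rat_comp[OF that dom(4)] comp[OF that] by simp_all
    have "foldr rat_comp [T123, T145, T246, T356] Var = foldr rat_comp [T356, T246, T145, T123] Var"
      by (simp add: comp dom_comp dominant_Var)
        (intro tetra_step_functional_equation; simp add: nz dominant_neq_0 dom_comp dominant_Var)
    then show ?thesis
      using dominant_rat_comps[of "[T123, T145, T246, T356]"]
        dominant_rat_comps[of "[T356, T246, T145, T123]"] dom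
      by simp
  qed
  then show ?thesis
    unfolding parametric_tetrahedron_map_def Let_def
    by (intro ballI tetrahedron[OF _ _ _ _ _ _ refl refl refl refl]) simp_all
qed

theorem theorem5p6:
  shows "parametric_tetrahedron_map (- {0}) tetra_map \<and>
    (\<forall>a b c. a \<noteq> 0 \<and> b \<noteq> 0 \<and> c \<noteq> 0 \<longrightarrow>
       noninvolutive (tetra_map a b c) \<and>
       birational (tetra_map a b c) \<and>
       rat_invariant (tetra_map a b c) (x1 + y1) \<and>
       rat_invariant (tetra_map a b c) (y1 * z1) \<and>
       rat_invariant (tetra_map a b c) (x1 / z1))"
  by (intro conjI allI impI parametric_tetrahedron_tetra_map noninvolutive_tetra_map
      birational_tetra_map rat_invariant_tetra_map) simp_all

end
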